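(* Let $\{a_s\}_{s=1}^{\infty}$ and $\{\tilde a_s\}_{s=1}^{\infty}$ be the real sequences defined by $a_1=a_2=\frac{5}{72}$, $\tilde a_1=\tilde a_2=-\frac{7}{72}$, and, for $s=2,3,4,\ldots$, $$a_{s+1}=\tfrac12 (s+1)a_s+\tfrac12\sum_{j=1}^{s-1}a_ja_{s-j},\qquad \tilde a_{s+1}=\tfrac12 (s+1)\tilde a_s+\tfrac12\sum_{j=1}^{s-1}\tilde a_j\tilde a_{s-j}.$$ Then $a_s>0$ and $\tilde a_s<0$ for all $s\ge 1$, and moreover, for all $s\geq 1$, $$\tfrac{5}{36}\left(\tfrac12\right)^s s!\ \le\ a_s\ \le\ \tfrac{5}{36}\left(\tfrac{4453}{6912}\right)^s s!$$ and $$\tfrac{7}{36}\left(\tfrac12\right)^s (s-1)!\ \le\ |\tilde a_s|\ \le\ \tfrac{7}{36}\left(\tfrac12\right)^s s!.$$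
   Context: No further notation is needed. *)

theory Defs
  imports Complex_Main
begin

end

theory Submission
  imports Defs
begin

text \<open>
  The linear part \<open>u (s + 1) = (s + 1) / 2 * u s\<close> of the recursion has the exact solution
  \<open>K * (1 / 2) ^ s * fact s\<close>, where \<open>K = 2 * u 1\<close>.  The quadratic part is a small perturbation,
  because in the convolution \<open>\<Sum>j = 1..s - 1. fact j * fact (s - j)\<close> the two outermost terms
  dominate: the sum is at most \<open>4 * fact (s - 1)\<close> (lemma \<open>sum_fact_mult_fact_le\<close>), whereas the
  linear part has the order of \<open>fact (s + 1)\<close>.  Since \<open>a 2 = a 1\<close> and \<open>b 2 = b 1\<close>, both recursions
  already hold at \<open>s = 1\<close>, with an empty convolution, so the inductions start at \<open>s = 1\<close>.

  For positive values the quadratic term helps the lower bound, and it can be absorbed in the upper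
  bound by raising the rate \<open>1 / 2\<close> to any \<open>c \<ge> 1 / 2 + K\<close>.  For \<open>a\<close> this requires
  \<open>4453 / 6912 \<ge> 1 / 2 + 5 / 36\<close>.

  For \<open>u = - b\<close> the quadratic term is subtracted, so the upper bound keeps the rate \<open>1 / 2\<close>.  In the
  lower bound the factor \<open>s + 1\<close> is split: \<open>s\<close> of it produces \<open>fact s\<close> from \<open>fact (s - 1)\<close>, and
  the remaining \<open>1\<close> pays for the quadratic term.  This is possible as soon as
  \<open>K \<le> 1 / 4\<close>, and here \<open>K = 7 / 36\<close>.
\<close>

section \<open>Convolutions of factorials\<close>

text \<open>
  Factorials are log-convex, so with a fixed sum of the arguments the product grows as the
  arguments move apart.
\<close>

lemma fact_mult_fact_le:
  assumes "k \<le> m" "k \<le> n"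
  shows "fact m * fact n \<le> (fact k * fact (m + n - k) :: real)"
  using assms(1)
proof (induction m rule: dec_induct)
  case base
  then show ?case by simp
next
  case (step m)
  have "fact (Suc m) * fact n = real (Suc m) * (fact m * fact n)"
    by simp
  also have "\<dots> \<le> real (Suc (m + n - k)) * (fact k * fact (m + n - k))"
    using assms(2) by (intro mult_mono step.IH) auto
  also have "\<dots> = fact k * fact (Suc (m + n - k))"
    by simp
  also have "Suc (m + n - k) = Suc m + n - k"
    using assms(2) by simp
  finally show ?case .
qed

text \<open>
  The two end terms contribute \<open>2 * fact (s - 1)\<close>.  Each of the \<open>s - 3\<close> inner terms is at most
  \<open>2 * fact (s - 2)\<close>, so that together they contribute no more than the end terms do.
\<close>

lemma sum_fact_mult_fact_le:
  "(\<Sum>j = 1..s - 1. fact j * fact (s - j)) \<le> (4 * fact (s - 1) :: real)"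
proof (cases "s \<le> 2")
  case True
  then consider "s = 0" | "s = 1" | "s = 2" by linarith
  then show ?thesis by cases auto
next
  case False
  then obtain t where t: "s = t + 3"
    by (intro that[of "s - 3"]) auto
  have inner: "fact j * fact (s - j) \<le> (2 * fact (t + 1) :: real)" if "j \<in> {2..t + 1}" for j
    using fact_mult_fact_le[of 2 j "s - j"] that t by (auto simp: fact_numeral)
  have "{1..s - 1} = insert 1 (insert (t + 2) {2..t + 1})"
    using t by auto
  then have "(\<Sum>j = 1..s - 1. fact j * fact (s - j))
      = (2 * fact (t + 2) + (\<Sum>j = 2..t + 1. fact j * fact (s - j)) :: real)"
    using t by simp
  also have "\<dots> \<le> 2 * fact (t + 2) + real t * (2 * fact (t + 1))"
    using sum_bounded_above[of "{2..t + 1}" "\<lambda>j. fact j * fact (s - j) :: real", OF inner]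
    by (simp del: sum.cl_ivl_Suc)
  also have "\<dots> \<le> 4 * fact (t + 2)"
    by (simp add: algebra_simps)
  finally show ?thesis using t by simp
qed

lemma sum_convolution_le:
  fixes u :: "nat \<Rightarrow> real"
  assumes "0 \<le> K" "0 \<le> c"
    and nonneg: "\<And>j. 1 \<le> j \<Longrightarrow> j < s \<Longrightarrow> 0 \<le> u j"
    and le: "\<And>j. 1 \<le> j \<Longrightarrow> j < s \<Longrightarrow> u j \<le> K * c ^ j * fact j"
  shows "(\<Sum>j = 1..s - 1. u j * u (s - j)) \<le> 4 * K\<^sup>2 * c ^ s * fact (s - 1)"
proof -
  have "(\<Sum>j = 1..s - 1. u j * u (s - j))
      \<le> (\<Sum>j = 1..s - 1. K\<^sup>2 * c ^ s * (fact j * fact (s - j)))"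
  proof (rule sum_mono)
    fix j assume j: "j \<in> {1..s - 1}"
    then have "u j * u (s - j) \<le> (K * c ^ j * fact j) * (K * c ^ (s - j) * fact (s - j))"
      using assms by (intro mult_mono) auto
    also have "\<dots> = K\<^sup>2 * (c ^ j * c ^ (s - j)) * (fact j * fact (s - j))"
      by (simp add: power2_eq_square)
    also have "c ^ j * c ^ (s - j) = c ^ s"
      using j by (auto simp flip: power_add intro: arg_cong)
    finally show "u j * u (s - j) \<le> K\<^sup>2 * c ^ s * (fact j * fact (s - j))" .
  qed
  also have "\<dots> = K\<^sup>2 * c ^ s * (\<Sum>j = 1..s - 1. fact j * fact (s - j))"
    by (simp add: sum_distrib_left)
  also have "\<dots> \<le> K\<^sup>2 * c ^ s * (4 * fact (s - 1))"
    using assms by (intro mult_left_mono sum_fact_mult_fact_le) auto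
  finally show ?thesis by simp
qed

section \<open>The quadratic recursion with either sign\<close>

lemma added_convolution_lower_bound:
  fixes u :: "nat \<Rightarrow> real"
  assumes K: "0 < K" and init: "u 1 = K / 2"
    and rec: "\<And>s. 1 \<le> s \<Longrightarrow>
      u (s + 1) = 1 / 2 * real (s + 1) * u s + 1 / 2 * (\<Sum>j = 1..s - 1. u j * u (s - j))"
    and s: "1 \<le> s"
  shows "K * (1 / 2) ^ s * fact s \<le> u s"
  using s
proof (induction s rule: less_induct)
  case (less s)
  show ?case
  proof (cases "s = 1")
    case True
    then show ?thesis using init by simp
  next
    case False
    define t where "t = s - 1"
    have t: "s = t + 1" "1 \<le> t"
      using False less.prems by (simp_all add: t_def)
    have nonneg: "0 \<le> u j" if "1 \<le> j" "j \<le> t" for j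
      by (rule order_trans[of 0 "K * (1 / 2) ^ j * fact j"]) (use less.IH[of j] that t K in auto)
    have "0 \<le> (\<Sum>j = 1..t - 1. u j * u (t - j))"
      by (intro sum_nonneg mult_nonneg_nonneg nonneg) auto
    then have "1 / 2 * real (t + 1) * u t \<le> u (t + 1)"
      using rec[OF t(2)] by linarith
    moreover have "1 / 2 * real (t + 1) * (K * (1 / 2) ^ t * fact t) \<le> 1 / 2 * real (t + 1) * u t"
      using less.IH[of t] t by (intro mult_left_mono) auto
    moreover have "1 / 2 * real (t + 1) * (K * (1 / 2) ^ t * fact t)
        = K * (1 / 2) ^ (t + 1) * fact (t + 1)"
      by (simp add: algebra_simps)
    ultimately show ?thesis unfolding t(1) by linarith
  qed
qed

text \<open>
  The condition on \<open>c\<close> makes \<open>(c - 1 / 2) * fact (s + 1)\<close> large enough for the quadratic term, which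
  relative to \<open>K * c ^ s\<close> is at most \<open>2 * K * fact (s - 1)\<close>; here \<open>fact (s + 1) \<ge> 2 * fact (s - 1)\<close>.
\<close>

lemma added_convolution_upper_bound:
  fixes u :: "nat \<Rightarrow> real"
  assumes K: "0 < K" and c: "1 / 2 + K \<le> c" and init: "u 1 = K / 2"
    and rec: "\<And>s. 1 \<le> s \<Longrightarrow>
      u (s + 1) = 1 / 2 * real (s + 1) * u s + 1 / 2 * (\<Sum>j = 1..s - 1. u j * u (s - j))"
    and s: "1 \<le> s"
  shows "u s \<le> K * c ^ s * fact s"
  using s
proof (induction s rule: less_induct)
  case (less s)
  show ?case
  proof (cases "s = 1")
    case True
    have "K * (1 / 2) \<le> K * c"
      using K c by (intro mult_left_mono) auto
    then show ?thesis using True init by simp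
  next
    case False
    define t where "t = s - 1"
    have t: "s = t + 1" "1 \<le> t"
      using False less.prems by (simp_all add: t_def)
    have nonneg: "0 \<le> u j" if "1 \<le> j" for j
      by (rule order_trans[OF _ added_convolution_lower_bound[OF K init rec that]]) (use K in auto)
    have le: "u j \<le> K * c ^ j * fact j" if "1 \<le> j" "j \<le> t" for j
      using less.IH[of j] that t by simp
    have "(\<Sum>j = 1..t - 1. u j * u (t - j)) \<le> 4 * K\<^sup>2 * c ^ t * fact (t - 1)"
      by (rule sum_convolution_le) (use K c nonneg le in auto)
    moreover have "1 / 2 * real (t + 1) * u t \<le> 1 / 2 * real (t + 1) * (K * c ^ t * fact t)"
      using less.IH[of t] t by (intro mult_left_mono) auto
    ultimately have "u (t + 1)
        \<le> 1 / 2 * real (t + 1) * (K * c ^ t * fact t) + 1 / 2 * (4 * K\<^sup>2 * c ^ t * fact (t - 1))"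
      using rec[OF t(2)] by linarith
    also have "\<dots> = K * c ^ t * (1 / 2 * fact (t + 1) + K * (2 * fact (t - 1)))"
      by (simp add: algebra_simps power2_eq_square)
    also have "\<dots> \<le> K * c ^ t * (1 / 2 * fact (t + 1) + K * fact (t + 1))"
    proof -
      have "2 * fact (t - 1) \<le> (real (t + 1) * real t) * fact (t - 1)"
        using t mult_mono[of 2 "real (t + 1)" 1 "real t"] by (intro mult_right_mono) auto
      also have "\<dots> = fact (t + 1)"
        using t by (simp add: fact_reduce)
      finally show ?thesis
        using K c by (intro mult_left_mono add_left_mono) auto
    qed
    also have "\<dots> = K * c ^ t * ((1 / 2 + K) * fact (t + 1))"
      by (simp add: algebra_simps)
    also have "\<dots> \<le> K * c ^ t * (c * fact (t + 1))"
      using K c by (intro mult_left_mono mult_right_mono) auto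
    finally show ?thesis using t by (simp add: algebra_simps)
  qed
qed

text \<open>
  The bounds are proved together: the lower bound on the next value needs the upper bounds on
  earlier values, which control the subtracted convolution, and the upper bound on the next value
  needs the convolution to be nonnegative, which follows from the lower bounds.
\<close>

lemma subtracted_convolution_bounds:
  fixes u :: "nat \<Rightarrow> real"
  assumes K: "0 < K" "K \<le> 1 / 4" and init: "u 1 = K / 2"
    and rec: "\<And>s. 1 \<le> s \<Longrightarrow>
      u (s + 1) = 1 / 2 * real (s + 1) * u s - 1 / 2 * (\<Sum>j = 1..s - 1. u j * u (s - j))"
    and s: "1 \<le> s"
  shows "K * (1 / 2) ^ s * fact (s - 1) \<le> u s \<and> u s \<le> K * (1 / 2) ^ s * fact s"
  using s
proof (induction s rule: less_induct)
  case (less s)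
  show ?case
  proof (cases "s = 1")
    case True
    then show ?thesis using init by simp
  next
    case False
    define t where "t = s - 1"
    have t: "s = t + 1" "1 \<le> t"
      using False less.prems by (simp_all add: t_def)
    define q where "q = (\<Sum>j = 1..t - 1. u j * u (t - j))"
    have nonneg: "0 \<le> u j" if "1 \<le> j" "j \<le> t" for j
      by (rule order_trans[of 0 "K * (1 / 2) ^ j * fact (j - 1)"])
        (use less.IH[of j] that t K in auto)
    have le: "u j \<le> K * (1 / 2) ^ j * fact j" if "1 \<le> j" "j \<le> t" for j
      using less.IH[of j] that t by simp
    have next_u: "u (t + 1) = 1 / 2 * real (t + 1) * u t - 1 / 2 * q"
      using rec[OF t(2)] by (simp add: q_def)
    have "0 \<le> q"
      unfolding q_def by (intro sum_nonneg mult_nonneg_nonneg nonneg) auto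
    then have "u (t + 1) \<le> 1 / 2 * real (t + 1) * u t"
      using next_u by linarith
    also have "\<dots> \<le> 1 / 2 * real (t + 1) * (K * (1 / 2) ^ t * fact t)"
      using less.IH[of t] t by (intro mult_left_mono) auto
    also have "\<dots> = K * (1 / 2) ^ (t + 1) * fact (t + 1)"
      by (simp add: algebra_simps)
    finally have upper: "u (t + 1) \<le> K * (1 / 2) ^ (t + 1) * fact (t + 1)" .
    have "q \<le> 4 * K\<^sup>2 * (1 / 2) ^ t * fact (t - 1)"
      unfolding q_def by (rule sum_convolution_le) (use K nonneg le in auto)
    also have "\<dots> = 4 * K * (K * (1 / 2) ^ t * fact (t - 1))"
      by (simp add: power2_eq_square)
    also have "\<dots> \<le> 1 * (K * (1 / 2) ^ t * fact (t - 1))"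
      using K by (intro mult_right_mono) auto
    also have "\<dots> \<le> u t"
      using less.IH[of t] t by simp
    finally have "q \<le> u t" .
    \<comment> \<open>One summand \<open>u t\<close> of \<open>(t + 1) * u t\<close> pays for the convolution \<open>q\<close>.\<close>
    then have "1 / 2 * real t * u t \<le> u (t + 1)"
      using next_u by (simp add: algebra_simps)
    moreover have "1 / 2 * real t * (K * (1 / 2) ^ t * fact (t - 1)) \<le> 1 / 2 * real t * u t"
      using less.IH[of t] t by (intro mult_left_mono) auto
    moreover have "1 / 2 * real t * (K * (1 / 2) ^ t * fact (t - 1))
        = K * (1 / 2) ^ (t + 1) * fact (t + 1 - 1)"
      using t by (simp add: fact_reduce)
    ultimately show ?thesis unfolding t(1) using upper by linarith
  qed
qed

section \<open>Bounds for the two sequences\<close>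

theorem theorem1p2:
  fixes a b :: "nat \<Rightarrow> real"
  assumes a1: "a 1 = 5 / 72" and a2: "a 2 = 5 / 72"
    and a_rec: "\<And>s. s \<ge> 2 \<Longrightarrow>
      a (s + 1) = 1 / 2 * real (s + 1) * a s + 1 / 2 * (\<Sum>j = 1..s - 1. a j * a (s - j))"
    and b1: "b 1 = - 7 / 72" and b2: "b 2 = - 7 / 72"
    and b_rec: "\<And>s. s \<ge> 2 \<Longrightarrow>
      b (s + 1) = 1 / 2 * real (s + 1) * b s + 1 / 2 * (\<Sum>j = 1..s - 1. b j * b (s - j))"
  shows "\<forall>s\<ge>1. a s > 0 \<and> b s < 0 \<and>
      5 / 36 * (1 / 2) ^ s * fact s \<le> a s \<and>
      a s \<le> 5 / 36 * (4453 / 6912) ^ s * fact s \<and>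
      7 / 36 * (1 / 2) ^ s * fact (s - 1) \<le> \<bar>b s\<bar> \<and>
      \<bar>b s\<bar> \<le> 7 / 36 * (1 / 2) ^ s * fact s"
proof (intro allI impI)
  fix s :: nat assume s: "1 \<le> s"
  have a_rec_from_1: "a (t + 1)
      = 1 / 2 * real (t + 1) * a t + 1 / 2 * (\<Sum>j = 1..t - 1. a j * a (t - j))" if "1 \<le> t" for t
    using a_rec[of t] a1 a2 that by (cases "t = 1") (auto simp: numeral_2_eq_2)
  have minus_b_rec_from_1: "- b (t + 1)
      = 1 / 2 * real (t + 1) * (- b t) - 1 / 2 * (\<Sum>j = 1..t - 1. (- b j) * (- b (t - j)))"
    if "1 \<le> t" for t
    using b_rec[of t] b1 b2 that by (cases "t = 1") (auto simp: numeral_2_eq_2)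
  have a_lower: "5 / 36 * (1 / 2) ^ s * fact s \<le> a s"
    by (rule added_convolution_lower_bound[OF _ _ a_rec_from_1 s]) (use a1 in auto)
  have a_upper: "a s \<le> 5 / 36 * (4453 / 6912) ^ s * fact s"
    by (rule added_convolution_upper_bound[OF _ _ _ a_rec_from_1 s]) (use a1 in auto)
  have b_bounds: "7 / 36 * (1 / 2) ^ s * fact (s - 1) \<le> - b s
      \<and> - b s \<le> 7 / 36 * (1 / 2) ^ s * fact s"
    by (rule subtracted_convolution_bounds[where u = "\<lambda>t. - b t", OF _ _ _ minus_b_rec_from_1 s])
      (use b1 in auto)
  have "0 < 5 / 36 * (1 / 2) ^ s * (fact s :: real)"
    "0 < 7 / 36 * (1 / 2) ^ s * (fact (s - 1) :: real)"
    by simp_all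
  then have "0 < a s" "b s < 0"
    using a_lower b_bounds by linarith+
  then show "a s > 0 \<and> b s < 0 \<and>
      5 / 36 * (1 / 2) ^ s * fact s \<le> a s \<and>
      a s \<le> 5 / 36 * (4453 / 6912) ^ s * fact s \<and>
      7 / 36 * (1 / 2) ^ s * fact (s - 1) \<le> \<bar>b s\<bar> \<and>
      \<bar>b s\<bar> \<le> 7 / 36 * (1 / 2) ^ s * fact s"
    using a_lower a_upper b_bounds by simp
qed

end
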